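(* Every half-integral zonotope coincides, up to an affine, bijective transformation, with a graphical zonotope. That is, for every half-integral zonotope $Z$ there exist a finite simple graph $G$ and an affine bijection from the affine hull of $Z$ onto the affine hull of the graphical zonotope $Z(G)$ that maps $Z$ onto $Z(G)$.
   Context: A zonotope is a Minkowski sum of finitely many line segments in $\mathbb{R}^d$ (for some $d$). A zonotope in $\mathbb{R}^d$ is called half-integral if all its vertices belong to $\{0,1/2,1\}^d$. A graphical zonotope is the Minkowski sum of a subset of the edges of a standard simplex. More precisely, given a graph $G$ with $n$ vertices, identify the vertices of $G$ with the vertices $e^1,\dots,e^n$ of the $(n-1)$-dimensional standard simplex in $\mathbb{R}^n$ (the vectors of the canonical basis); the graphical zonotope $Z(G)$ of $G$ is the Minkowski sum of the segments $\mathrm{conv}\{e^i,e^j\}$ over all edges $\{i,j\}$ of $G$. It is well defined up to isometry. (If $G$ has no edge, $Z(G)$ is a single point.) *)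

theory Defs
  imports
    "HOL-Analysis.Analysis"
    "HOL-Analysis.Finite_Function_Topology"
    "HOL-Library.Set_Algebras"
begin

text \<open>
  Addition and finite sums of sets are those of \<^theory>\<open>HOL-Library.Set_Algebras\<close>,
  i.e. Minkowski sums; the empty sum is the singleton of the origin.
\<close>

definition zonotope :: "'a::real_vector set \<Rightarrow> bool" where
  "zonotope Z \<longleftrightarrow>
     (\<exists>(m::nat) a b. Z = (\<Sum>k<m. closed_segment (a k) (b k)))"

definition half_integral_zonotope :: "(real ^ 'd) set \<Rightarrow> bool" where
  "half_integral_zonotope Z \<longleftrightarrow>
     zonotope Z \<and> (\<forall>v. v extreme_point_of Z \<longrightarrow> (\<forall>i. v $ i \<in> {0, 1/2, 1}))"

text \<open>The standard simplex on \<open>V\<close> needs at least one vertex, hence \<open>V \<noteq> {}\<close>.\<close>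

definition finite_simple_graph :: "'v set \<Rightarrow> 'v set set \<Rightarrow> bool" where
  "finite_simple_graph V E \<longleftrightarrow>
     finite V \<and> V \<noteq> {} \<and> (\<forall>e\<in>E. e \<subseteq> V \<and> card e = 2)"

text \<open>
  The number of vertices of a graph is not bounded in advance, so the spaces \<open>\<real>\<^sup>V\<close>, for all finite
  \<open>V\<close>, are realized together in the real vector space of finitely supported functions: \<open>\<real>\<^sup>V\<close>
  consists of the functions supported in \<open>V\<close>.
\<close>

definition basis_vec :: "'v \<Rightarrow> 'v \<Rightarrow>\<^sub>0 real" where
  "basis_vec i = Poly_Mapping.single i 1"

text \<open>
  Isolated vertices contribute no summand, so the zonotope is a function of the edge set only.
  For \<open>e = {i, j}\<close> the summand is the segment joining the basis vectors of \<open>i\<close> and \<open>j\<close>.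
\<close>

definition graphical_zonotope :: "'v set set \<Rightarrow> ('v \<Rightarrow>\<^sub>0 real) set" where
  "graphical_zonotope E = (\<Sum>e\<in>E. convex hull (basis_vec ` e))"

definition affine_map_on ::
  "'a::real_vector set \<Rightarrow> ('a \<Rightarrow> 'b::real_vector) \<Rightarrow> bool" where
  "affine_map_on A f \<longleftrightarrow>
     (\<forall>x\<in>A. \<forall>y\<in>A. \<forall>u v. u + v = 1 \<longrightarrow>
        f (u *\<^sub>R x + v *\<^sub>R y) = u *\<^sub>R f x + v *\<^sub>R f y)"

end

theory Submission
  imports Defs
begin

text \<open>
  Write a half-integral zonotope as \<open>Z = c + (\<Sum>k\<in>A. closed_segment 0 (g k))\<close> with nonzero, pairwise
  non-parallel generators (\<open>irredundant_cube_image\<close>).  Such a generator is the difference of two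
  vertices of \<open>Z\<close> (\<open>cube_image_edge\<close>), so its coordinates lie in \<open>{-1, -1/2, 0, 1/2, 1}\<close>.  On the other
  hand \<open>Z\<close> lies in the unit cube, and its width \<open>\<Sum>k\<in>A. \<bar>g k $ i\<bar>\<close> in each coordinate direction is at
  most \<open>1\<close>.  Hence each coordinate is nonzero on at most two generators, and if on two, then with equal
  absolute values (\<open>half_integral_generators\<close>, \<open>half_integral_rows\<close>).

  Consequently every coordinate of the equation \<open>\<Sum>k\<in>A. x k *\<^sub>R g k = 0\<close> is trivial or has one of the forms
  \<open>x k = 0\<close> and \<open>x k = \<plusminus> x l\<close>.  Up to signs of the generators, which only move the base point, the
  relations are thus spanned by the relations \<open>\<Sum>k\<in>C. g k = 0\<close> for pairwise disjoint sets \<open>C\<close>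
  (\<open>signed_relation_classes\<close>), and each \<open>C\<close> has at least three elements.  The edge vectors of a
  graph that consists of a cycle of length \<open>card C\<close> for each \<open>C\<close>, and of a separate edge for each
  generator in no \<open>C\<close>, satisfy exactly the same relations (\<open>permutation_graph_relations\<close>).  Zonotopes
  whose generators satisfy the same linear relations are affinely equivalent
  (\<open>affine_equivalence_of_same_relations\<close>).
\<close>

section \<open>Zonotopes as affine images of cubes\<close>

text \<open>
  A zonotope in coordinates along its generators: \<open>c\<close> is a base point and \<open>g\<close> lists the edge vectors,
  indexed by \<open>A\<close>.  Keeping the coefficients \<open>x\<close> visible is what allows two zonotopes to be compared
  through the linear relations of their generators.
\<close>

definition cube_image :: "'a::real_vector \<Rightarrow> 'i set \<Rightarrow> ('i \<Rightarrow> 'a) \<Rightarrow> 'a set" where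
  "cube_image c A g = {c + (\<Sum>k\<in>A. x k *\<^sub>R g k) |x. \<forall>k\<in>A. 0 \<le> x k \<and> x k \<le> 1}"

lemma cube_imageI:
  assumes "p = c + (\<Sum>k\<in>A. x k *\<^sub>R g k)" "\<And>k. k \<in> A \<Longrightarrow> 0 \<le> x k" "\<And>k. k \<in> A \<Longrightarrow> x k \<le> 1"
  shows "p \<in> cube_image c A g"
  using assms unfolding cube_image_def by blast

lemma cube_imageE:
  assumes "p \<in> cube_image c A g"
  obtains x where "p = c + (\<Sum>k\<in>A. x k *\<^sub>R g k)" "\<And>k. k \<in> A \<Longrightarrow> 0 \<le> x k" "\<And>k. k \<in> A \<Longrightarrow> x k \<le> 1"
  using assms unfolding cube_image_def by blast

lemma cube_image_cong:
  assumes "c = c'" "A = A'" "\<And>k. k \<in> A' \<Longrightarrow> g k = g' k"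
  shows "cube_image c A g = cube_image c' A' g'"
  using assms unfolding cube_image_def by (simp cong: sum.cong)

lemma sum_closed_segment_eq_cube_image:
  fixes a b :: "'i \<Rightarrow> 'a::real_vector"
  assumes fin: "finite A"
  shows "(\<Sum>k\<in>A. closed_segment (a k) (b k)) = cube_image (\<Sum>k\<in>A. a k) A (\<lambda>k. b k - a k)"
proof (intro equalityI subsetI)
  fix p assume "p \<in> (\<Sum>k\<in>A. closed_segment (a k) (b k))"
  then obtain s where p: "p = sum s A" and s: "\<forall>k\<in>A. s k \<in> closed_segment (a k) (b k)"
    unfolding set_sum_alt[OF fin] by blast
  from s have "\<forall>k\<in>A. \<exists>u. s k = (1 - u) *\<^sub>R a k + u *\<^sub>R b k \<and> 0 \<le> u \<and> u \<le> 1"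
    unfolding in_segment by blast
  then obtain u where u: "\<forall>k\<in>A. s k = (1 - u k) *\<^sub>R a k + u k *\<^sub>R b k \<and> 0 \<le> u k \<and> u k \<le> 1"
    by metis
  have "p = (\<Sum>k\<in>A. a k + u k *\<^sub>R (b k - a k))"
    unfolding p by (rule sum.cong) (use u in \<open>auto simp: algebra_simps\<close>)
  then show "p \<in> cube_image (\<Sum>k\<in>A. a k) A (\<lambda>k. b k - a k)"
    by (intro cube_imageI[where x = u]) (use u in \<open>auto simp: sum.distrib\<close>)
next
  fix p assume "p \<in> cube_image (\<Sum>k\<in>A. a k) A (\<lambda>k. b k - a k)"
  then obtain x where p: "p = (\<Sum>k\<in>A. a k) + (\<Sum>k\<in>A. x k *\<^sub>R (b k - a k))"
    and x: "\<And>k. k \<in> A \<Longrightarrow> 0 \<le> x k" "\<And>k. k \<in> A \<Longrightarrow> x k \<le> 1"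
    by (elim cube_imageE) blast
  have "p = (\<Sum>k\<in>A. (1 - x k) *\<^sub>R a k + x k *\<^sub>R b k)"
    unfolding p sum.distrib[symmetric] by (rule sum.cong) (auto simp: algebra_simps)
  moreover have "\<forall>k\<in>A. (1 - x k) *\<^sub>R a k + x k *\<^sub>R b k \<in> closed_segment (a k) (b k)"
    using x unfolding in_segment by blast
  ultimately show "p \<in> (\<Sum>k\<in>A. closed_segment (a k) (b k))"
    unfolding set_sum_alt[OF fin] by (intro CollectI exI[where x = "\<lambda>k. (1 - x k) *\<^sub>R a k + x k *\<^sub>R b k"]) auto
qed

text \<open>
  Reversing a generator moves the base point to the other end of the segment and replaces the
  coefficient \<open>x k\<close> by \<open>1 - x k\<close>.
\<close>

lemma cube_image_flip_subset:
  fixes e :: "'i \<Rightarrow> real"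
  assumes e: "\<And>k. k \<in> A \<Longrightarrow> e k = 1 \<or> e k = -1"
  shows "cube_image c A g \<subseteq> cube_image (c + (\<Sum>k\<in>A. if e k = 1 then 0 else g k)) A (\<lambda>k. e k *\<^sub>R g k)"
proof
  fix p assume "p \<in> cube_image c A g"
  then obtain x where p: "p = c + (\<Sum>k\<in>A. x k *\<^sub>R g k)"
    and x: "\<And>k. k \<in> A \<Longrightarrow> 0 \<le> x k" "\<And>k. k \<in> A \<Longrightarrow> x k \<le> 1"
    by (elim cube_imageE) blast
  have "(\<Sum>k\<in>A. x k *\<^sub>R g k) = (\<Sum>k\<in>A. (if e k = 1 then 0 else g k) + (if e k = 1 then x k else 1 - x k) *\<^sub>R e k *\<^sub>R g k)"
    by (rule sum.cong) (use e in \<open>force simp: algebra_simps\<close>)+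
  then show "p \<in> cube_image (c + (\<Sum>k\<in>A. if e k = 1 then 0 else g k)) A (\<lambda>k. e k *\<^sub>R g k)"
    by (intro cube_imageI[where x = "\<lambda>k. if e k = 1 then x k else 1 - x k"])
      (use x in \<open>auto simp: p sum.distrib\<close>)
qed

text \<open>
  Flipping the same signs twice restores the base point and the generators, so the inclusion applied
  to the flipped generators gives the reverse inclusion.
\<close>

lemma cube_image_flip:
  fixes e :: "'i \<Rightarrow> real"
  assumes e: "\<And>k. k \<in> A \<Longrightarrow> e k = 1 \<or> e k = -1"
  shows "cube_image c A g = cube_image (c + (\<Sum>k\<in>A. if e k = 1 then 0 else g k)) A (\<lambda>k. e k *\<^sub>R g k)"
    (is "_ = cube_image ?c' _ ?g'")
proof
  have "cube_image ?c' A ?g' \<subseteq> cube_image (?c' + (\<Sum>k\<in>A. if e k = 1 then 0 else ?g' k)) A (\<lambda>k. e k *\<^sub>R ?g' k)"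
    by (rule cube_image_flip_subset[OF e])
  also have "\<dots> = cube_image c A g"
  proof (rule cube_image_cong)
    have "(\<Sum>k\<in>A. if e k = 1 then 0 else g k) + (\<Sum>k\<in>A. if e k = 1 then 0 else ?g' k) = 0"
      unfolding sum.distrib[symmetric] by (rule sum.neutral) (use e in force)
    then show "?c' + (\<Sum>k\<in>A. if e k = 1 then 0 else ?g' k) = c"
      by (metis add.assoc add.right_neutral)
    show "e k *\<^sub>R e k *\<^sub>R g k = g k" if "k \<in> A" for k
      using e[OF that] by auto
  qed auto
  finally show "cube_image ?c' A ?g' \<subseteq> cube_image c A g" .
qed (rule cube_image_flip_subset[OF e])

lemma cube_image_remove_zero:
  assumes "finite A" "l \<in> A" "g l = 0"
  shows "cube_image c A g = cube_image c (A - {l}) g"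
proof -
  have eq: "(\<Sum>k\<in>A. x k *\<^sub>R g k) = (\<Sum>k\<in>A-{l}. x k *\<^sub>R g k)" for x
    using assms by (simp add: sum.remove)
  show ?thesis
  proof (intro equalityI subsetI)
    fix p assume "p \<in> cube_image c A g"
    then show "p \<in> cube_image c (A - {l}) g"
      by (elim cube_imageE, intro cube_imageI) (auto simp: eq)
  next
    fix p assume "p \<in> cube_image c (A - {l}) g"
    then obtain x where x: "p = c + (\<Sum>k\<in>A-{l}. x k *\<^sub>R g k)" "\<And>k. k \<in> A-{l} \<Longrightarrow> 0 \<le> x k" "\<And>k. k \<in> A-{l} \<Longrightarrow> x k \<le> 1"
      by (elim cube_imageE) blast
    show "p \<in> cube_image c A g"
      by (rule cube_imageI[where x = "\<lambda>k. if k = l then 0 else x k"])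
        (use x in \<open>auto simp: eq intro!: sum.cong\<close>)
  qed
qed

text \<open>
  Two segments pointing in the same direction add up to one segment.  In coordinates, \<open>x k\<close> and \<open>x l\<close>
  are replaced by their average with weights \<open>1\<close> and \<open>t\<close>.
\<close>

lemma cube_image_merge_nonneg:
  assumes fin: "finite A" and kl: "k \<in> A" "l \<in> A" "k \<noteq> l" and gl: "g l = t *\<^sub>R g k" and t: "t \<ge> 0"
  shows "cube_image c A g = cube_image c (A - {l}) (g(k := (1 + t) *\<^sub>R g k))" (is "_ = cube_image c _ ?g'")
proof -
  define B where "B = A - {k, l}"
  have A: "A = insert k (insert l B)" and B: "finite B" "k \<notin> B" "l \<notin> B" and Al: "A - {l} = insert k B"
    using kl fin by (auto simp: B_def)
  have eq1: "(\<Sum>j\<in>A. x j *\<^sub>R g j) = (x k + t * x l) *\<^sub>R g k + (\<Sum>j\<in>B. x j *\<^sub>R g j)" for x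
    unfolding A using B kl by (simp add: gl algebra_simps)
  have eq2: "(\<Sum>j\<in>A-{l}. x j *\<^sub>R ?g' j) = (x k * (1 + t)) *\<^sub>R g k + (\<Sum>j\<in>B. x j *\<^sub>R g j)" for x
  proof -
    have "(\<Sum>j\<in>B. x j *\<^sub>R ?g' j) = (\<Sum>j\<in>B. x j *\<^sub>R g j)"
      by (rule sum.cong) (use B in auto)
    then show ?thesis
      unfolding Al using B by simp
  qed
  show ?thesis
  proof (intro equalityI subsetI)
    fix p assume "p \<in> cube_image c A g"
    then obtain x where x: "p = c + (\<Sum>k\<in>A. x k *\<^sub>R g k)" "\<And>k. k \<in> A \<Longrightarrow> 0 \<le> x k" "\<And>k. k \<in> A \<Longrightarrow> x k \<le> 1"
      by (elim cube_imageE) blast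
    have "t * x l \<le> t * 1"
      using x(3)[OF kl(2)] t by (rule mult_left_mono)
    then have le: "(x k + t * x l) / (1 + t) \<le> 1"
      using x(3)[OF kl(1)] t by (simp add: field_simps)
    show "p \<in> cube_image c (A - {l}) ?g'"
    proof (rule cube_imageI[where x = "x(k := (x k + t * x l) / (1 + t))"])
      have "(\<Sum>j\<in>B. (x(k := (x k + t * x l) / (1 + t))) j *\<^sub>R g j) = (\<Sum>j\<in>B. x j *\<^sub>R g j)"
        by (rule sum.cong) (use B in auto)
      then show "p = c + (\<Sum>j\<in>A-{l}. (x(k := (x k + t * x l) / (1 + t))) j *\<^sub>R ?g' j)"
        unfolding eq2 x(1) eq1 using t by simp
    qed (use x le t kl in auto)
  next
    fix p assume "p \<in> cube_image c (A - {l}) ?g'"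
    then obtain x where x: "p = c + (\<Sum>j\<in>A-{l}. x j *\<^sub>R ?g' j)" "\<And>k. k \<in> A-{l} \<Longrightarrow> 0 \<le> x k" "\<And>k. k \<in> A-{l} \<Longrightarrow> x k \<le> 1"
      by (elim cube_imageE) blast
    show "p \<in> cube_image c A g"
    proof (rule cube_imageI[where x = "x(l := x k)"])
      have "(\<Sum>j\<in>B. (x(l := x k)) j *\<^sub>R g j) = (\<Sum>j\<in>B. x j *\<^sub>R g j)"
        by (rule sum.cong) (use B in auto)
      then show "p = c + (\<Sum>j\<in>A. (x(l := x k)) j *\<^sub>R g j)"
        unfolding eq1 x(1) eq2 using kl by (simp add: algebra_simps)
    qed (use x kl in auto)
  qed
qed

text \<open>
  A generator pointing in the opposite direction is flipped before it is merged.
\<close>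

lemma cube_image_merge_parallel:
  assumes fin: "finite A" and kl: "k \<in> A" "l \<in> A" "k \<noteq> l" and gl: "g l = t *\<^sub>R g k"
  shows "\<exists>c' g'. cube_image c A g = cube_image c' (A - {l}) g'"
proof (cases "t \<ge> 0")
  case True
  then show ?thesis
    using cube_image_merge_nonneg[OF fin kl gl] by blast
next
  case False
  define e :: "_ \<Rightarrow> real" where "e j = (if j = l then -1 else 1)" for j
  define c1 where "c1 = c + (\<Sum>j\<in>A. if e j = 1 then 0 else g j)"
  have "cube_image c A g = cube_image c1 A (\<lambda>j. e j *\<^sub>R g j)"
    unfolding c1_def by (rule cube_image_flip) (auto simp: e_def)
  moreover have "e l *\<^sub>R g l = (- t) *\<^sub>R e k *\<^sub>R g k"
    using kl gl by (simp add: e_def)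
  ultimately show ?thesis
    using cube_image_merge_nonneg[OF fin kl, of "\<lambda>j. e j *\<^sub>R g j" "- t" c1] False by force
qed

text \<open>
  Deleting zero generators and merging parallel ones lowers the number of generators, so the process
  ends with generators that are nonzero and pairwise non-parallel.
\<close>

lemma irredundant_cube_image:
  fixes g :: "'i \<Rightarrow> 'a::real_vector"
  assumes "finite A" "Z = cube_image c A g"
  obtains c' A' and g' :: "'i \<Rightarrow> 'a" where "finite A'" "Z = cube_image c' A' g'"
    "\<And>k. k \<in> A' \<Longrightarrow> g' k \<noteq> 0"
    "\<And>k l t. k \<in> A' \<Longrightarrow> l \<in> A' \<Longrightarrow> k \<noteq> l \<Longrightarrow> g' l \<noteq> t *\<^sub>R g' k"
  using assms
proof (induction "card A" arbitrary: c A g thesis rule: less_induct)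
  case less
  show thesis
  proof (cases "\<exists>l\<in>A. \<exists>c' g'. Z = cube_image c' (A - {l}) g'")
    case True
    then obtain l c' g' where l: "l \<in> A" "Z = cube_image c' (A - {l}) g'"
      by blast
    have lt: "card (A - {l}) < card A" and fin: "finite (A - {l})"
      using card_Diff1_less[OF less.prems(2) l(1)] less.prems(2) by auto
    show thesis
      by (rule less.hyps[OF lt _ fin l(2)]) (rule less.prems(1))
  next
    case False
    have "g k \<noteq> 0" if "k \<in> A" for k
      using cube_image_remove_zero[OF less.prems(2) that, of g c] False that less.prems(3) by auto
    moreover have "g l \<noteq> t *\<^sub>R g k" if "k \<in> A" "l \<in> A" "k \<noteq> l" for k l t
      using cube_image_merge_parallel[OF less.prems(2) that, of g t c] False that less.prems(3) by auto
    ultimately show thesis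
      by (rule less.prems(1)[OF less.prems(2,3)])
  qed
qed

lemma convex_cube_image:
  assumes "finite A"
  shows "convex (cube_image c A g)"
proof (rule convexI)
  fix p q u v assume "p \<in> cube_image c A g" "q \<in> cube_image c A g" and uv: "0 \<le> u" "0 \<le> v" "u + v = (1::real)"
  then obtain x y where x: "p = c + (\<Sum>k\<in>A. x k *\<^sub>R g k)" "\<And>k. k \<in> A \<Longrightarrow> 0 \<le> x k" "\<And>k. k \<in> A \<Longrightarrow> x k \<le> 1"
    and y: "q = c + (\<Sum>k\<in>A. y k *\<^sub>R g k)" "\<And>k. k \<in> A \<Longrightarrow> 0 \<le> y k" "\<And>k. k \<in> A \<Longrightarrow> y k \<le> 1"
    by (elim cube_imageE) blast
  show "u *\<^sub>R p + v *\<^sub>R q \<in> cube_image c A g"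
  proof (rule cube_imageI[where x = "\<lambda>k. u * x k + v * y k"])
    have "u *\<^sub>R p + v *\<^sub>R q = (u + v) *\<^sub>R c + (\<Sum>k\<in>A. u *\<^sub>R x k *\<^sub>R g k + v *\<^sub>R y k *\<^sub>R g k)"
      unfolding x y sum.distrib by (simp add: algebra_simps scaleR_sum_right)
    then show "u *\<^sub>R p + v *\<^sub>R q = c + (\<Sum>k\<in>A. (u * x k + v * y k) *\<^sub>R g k)"
      using uv by (simp add: algebra_simps)
    show "u * x k + v * y k \<le> 1" if "k \<in> A" for k
      using convex_bound_le[OF x(3)[OF that] y(3)[OF that] uv] .
  qed (use x y uv in auto)
qed

lemma compact_cube_image:
  fixes g :: "'i \<Rightarrow> 'a::real_normed_vector"
  assumes "finite A"
  shows "compact (cube_image c A g)"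
proof -
  have "compact (\<Sum>k\<in>A. closed_segment 0 (g k))"
    using assms
  proof induction
    case (insert k A)
    have "closed_segment 0 (g k) + (\<Sum>k\<in>A. closed_segment 0 (g k))
        = {x + y |x y. x \<in> closed_segment 0 (g k) \<and> y \<in> (\<Sum>k\<in>A. closed_segment 0 (g k))}"
      by (auto simp: set_plus_def)
    then show ?case
      using insert compact_sums[of "closed_segment 0 (g k)"] by simp
  qed (simp add: set_zero)
  then have "compact (cube_image 0 A g)"
    by (simp add: sum_closed_segment_eq_cube_image[OF assms])
  moreover have "cube_image c A g = (+) c ` cube_image 0 A g"
    unfolding cube_image_def by (auto simp: image_def)
  ultimately show ?thesis
    by (simp add: compact_translation)
qed

text \<open>
  The cube \<open>{0..1}\<^sup>A\<close> affinely spans the whole coefficient space, and so does its image.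
\<close>

lemma affine_hull_cube_image:
  assumes fin: "finite A"
  shows "affine hull (cube_image c A g) = {c + (\<Sum>k\<in>A. x k *\<^sub>R g k) |x. True}" (is "?H = ?R")
proof
  show "?H \<subseteq> ?R"
  proof (rule hull_minimal)
    show "cube_image c A g \<subseteq> ?R"
      by (auto elim: cube_imageE)
    show "affine ?R"
      unfolding affine_def
    proof clarify
      fix u v :: real and x y assume uv: "u + v = 1"
      have "u *\<^sub>R (c + (\<Sum>k\<in>A. x k *\<^sub>R g k)) + v *\<^sub>R (c + (\<Sum>k\<in>A. y k *\<^sub>R g k))
          = (u + v) *\<^sub>R c + (\<Sum>k\<in>A. u *\<^sub>R x k *\<^sub>R g k + v *\<^sub>R y k *\<^sub>R g k)"
        unfolding sum.distrib by (simp add: algebra_simps scaleR_sum_right)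
      also have "\<dots> = c + (\<Sum>k\<in>A. (u * x k + v * y k) *\<^sub>R g k)"
        using uv by (simp add: algebra_simps)
      finally show "\<exists>z. u *\<^sub>R (c + (\<Sum>k\<in>A. x k *\<^sub>R g k)) + v *\<^sub>R (c + (\<Sum>k\<in>A. y k *\<^sub>R g k))
          = c + (\<Sum>k\<in>A. z k *\<^sub>R g k) \<and> True"
        by (intro exI[where x = "\<lambda>k. u * x k + v * y k"] conjI) simp_all
    qed
  qed
  show "?R \<subseteq> ?H"
  proof clarify
    fix x
    have c: "c \<in> ?H"
      by (rule hull_inc, rule cube_imageI[where x = "\<lambda>_. 0"]) auto
    have cg: "c + g k \<in> ?H" if "k \<in> A" for k
      by (rule hull_inc, rule cube_imageI[where x = "\<lambda>j. if j = k then 1 else 0"])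
        (use that fin in \<open>auto simp: if_distrib[of "\<lambda>r. r *\<^sub>R _"] cong: if_cong\<close>)
    have "c + (\<Sum>k\<in>B. x k *\<^sub>R g k) \<in> ?H" if "B \<subseteq> A" for B
      using finite_subset[OF that fin] that
    proof (induction B)
      case (insert k B)
      then have "c + (\<Sum>k\<in>B. x k *\<^sub>R g k) + x k *\<^sub>R ((c + g k) - c) \<in> ?H"
        by (intro mem_affine_3_minus affine_affine_hull c cg) auto
      then show ?case
        using insert by (simp add: algebra_simps)
    qed (use c in simp)
    then show "c + (\<Sum>k\<in>A. x k *\<^sub>R g k) \<in> ?H"
      by blast
  qed
qed

text \<open>
  A zonotope is determined up to affine bijection by the linear relations of its generators: if \<open>g\<close>
  and \<open>h\<close> satisfy the same relations, two coefficient vectors give the same point for \<open>g\<close> iff they do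
  for \<open>h\<close>, so transporting coefficients is a well-defined bijection of the affine hulls.
\<close>

lemma affine_equivalence_of_same_relations:
  fixes g :: "'i \<Rightarrow> 'a::real_vector" and h :: "'i \<Rightarrow> 'b::real_vector"
  assumes fin: "finite A"
    and rel: "\<And>x. (\<Sum>k\<in>A. x k *\<^sub>R g k) = 0 \<longleftrightarrow> (\<Sum>k\<in>A. x k *\<^sub>R h k) = 0"
  shows "\<exists>f. affine_map_on (affine hull (cube_image c A g)) f \<and>
             bij_betw f (affine hull (cube_image c A g)) (affine hull (cube_image d A h)) \<and>
             f ` cube_image c A g = cube_image d A h"
proof -
  have eq: "(\<Sum>k\<in>A. x k *\<^sub>R g k) = (\<Sum>k\<in>A. y k *\<^sub>R g k) \<longleftrightarrow> (\<Sum>k\<in>A. x k *\<^sub>R h k) = (\<Sum>k\<in>A. y k *\<^sub>R h k)" for x y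
    using rel[of "\<lambda>k. x k - y k"] by (simp add: scaleR_diff_left sum_subtractf)
  define G where "G x = c + (\<Sum>k\<in>A. x k *\<^sub>R g k)" for x
  define H where "H x = d + (\<Sum>k\<in>A. x k *\<^sub>R h k)" for x
  define f where "f p = H (SOME x. G x = p)" for p
  have GH: "G x = G y \<longleftrightarrow> H x = H y" for x y
    using eq[of x y] by (simp add: G_def H_def)
  have f: "f (G x) = H x" for x
    unfolding f_def using someI[of "\<lambda>y. G y = G x" x] GH by blast
  have hullG: "affine hull (cube_image c A g) = range G"
    and hullH: "affine hull (cube_image d A h) = range H"
    unfolding affine_hull_cube_image[OF fin] G_def H_def by auto
  have comb: "u *\<^sub>R G x + v *\<^sub>R G y = G (\<lambda>k. u * x k + v * y k)"
    "u *\<^sub>R H x + v *\<^sub>R H y = H (\<lambda>k. u * x k + v * y k)" if "u + v = 1" for u v x y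
  proof -
    have u: "u = 1 - v" using that by simp
    show "u *\<^sub>R G x + v *\<^sub>R G y = G (\<lambda>k. u * x k + v * y k)"
      unfolding G_def scaleR_add_left sum.distrib scaleR_scaleR[symmetric] scaleR_sum_right[symmetric]
      unfolding u by (simp add: algebra_simps)
    show "u *\<^sub>R H x + v *\<^sub>R H y = H (\<lambda>k. u * x k + v * y k)"
      unfolding H_def scaleR_add_left sum.distrib scaleR_scaleR[symmetric] scaleR_sum_right[symmetric]
      unfolding u by (simp add: algebra_simps)
  qed
  have "affine_map_on (range G) f"
    unfolding affine_map_on_def by (auto simp: comb f)
  moreover have "bij_betw f (range G) (range H)"
    unfolding bij_betw_def inj_on_def by (auto simp: f GH image_image)
  moreover have "f ` cube_image c A g = cube_image d A h"
  proof -
    have "cube_image c A g = G ` {x. \<forall>k\<in>A. 0 \<le> x k \<and> x k \<le> 1}"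
      "cube_image d A h = H ` {x. \<forall>k\<in>A. 0 \<le> x k \<and> x k \<le> 1}"
      unfolding cube_image_def G_def H_def by blast+
    then show ?thesis
      by (simp add: image_image f)
  qed
  ultimately show ?thesis
    unfolding hullG hullH by blast
qed

section \<open>Generators of a half-integral zonotope\<close>

text \<open>
  Finitely many hyperplanes form a null set, hence do not cover the space.
\<close>

lemma ex_inner_nonzero_on_finite:
  fixes H :: "'a::euclidean_space set"
  assumes "finite H" "0 \<notin> H"
  shows "\<exists>w. \<forall>h\<in>H. w \<bullet> h \<noteq> 0"
proof (rule ccontr)
  assume "\<nexists>w. \<forall>h\<in>H. w \<bullet> h \<noteq> 0"
  then have "(\<Union>h\<in>H. {w. h \<bullet> w = 0}) = UNIV"
    by (auto simp: inner_commute)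
  moreover have "negligible (\<Union>h\<in>H. {w. h \<bullet> w = 0})"
    using assms by (intro negligible_Union finite_imageI) (auto intro!: negligible_hyperplane)
  ultimately show False
    by simp
qed

text \<open>
  Every generator that is not parallel to another one is an edge, in the sense that it is a difference
  of two vertices: choose a linear functional that vanishes on \<open>g k\<close> and on no other generator.  The
  face on which it is maximal has all coefficients other than \<open>x k\<close> fixed at \<open>0\<close> or \<open>1\<close>, so it is a
  translate of the segment \<open>closed_segment 0 (g k)\<close>.
\<close>

lemma cube_image_edge:
  fixes g :: "'i \<Rightarrow> 'a::euclidean_space"
  assumes fin: "finite A" and k: "k \<in> A"
    and np: "\<And>l t. l \<in> A \<Longrightarrow> l \<noteq> k \<Longrightarrow> g l \<noteq> t *\<^sub>R g k"
  shows "\<exists>v. v extreme_point_of cube_image c A g \<and> v + g k extreme_point_of cube_image c A g"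
proof -
  define B where "B = A - {k}"
  have B: "finite B" "k \<notin> B" "A = insert k B"
    using fin k by (auto simp: B_def)
  \<comment> \<open>The functional is sought orthogonal to g k, so only the components of the other generators
      orthogonal to g k matter; they are nonzero because no g l is a multiple of g k.\<close>
  define h where "h l = g l - ((g l \<bullet> g k) / (g k \<bullet> g k)) *\<^sub>R g k" for l
  have "0 \<notin> h ` B"
    using np unfolding B_def h_def by fastforce
  then obtain w0 where w0: "\<And>l. l \<in> B \<Longrightarrow> w0 \<bullet> h l \<noteq> 0"
    using ex_inner_nonzero_on_finite[of "h ` B"] B(1) by blast
  define w where "w = w0 - ((w0 \<bullet> g k) / (g k \<bullet> g k)) *\<^sub>R g k"
  have wk: "w \<bullet> g k = 0"
    by (simp add: w_def inner_diff_left)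
  have wl: "w \<bullet> g l \<noteq> 0" if "l \<in> B" for l
    using w0[OF that] by (simp add: w_def h_def inner_diff_left inner_diff_right inner_commute mult.commute)
  \<comment> \<open>The coefficients that maximize the functional.\<close>
  define z :: "_ \<Rightarrow> real" where "z l = (if w \<bullet> g l > 0 then 1 else 0)" for l
  define v where "v = c + (\<Sum>l\<in>B. z l *\<^sub>R g l)"
  have gap: "w \<bullet> v - w \<bullet> (c + (\<Sum>l\<in>A. x l *\<^sub>R g l)) = (\<Sum>l\<in>B. (z l - x l) * (w \<bullet> g l))" for x
    using B wk by (simp add: v_def inner_add_right inner_sum_right sum_subtractf left_diff_distrib)
  have gap_nonneg: "0 \<le> (z l - x l) * (w \<bullet> g l)" if "0 \<le> x l" "x l \<le> 1" for x l
    using that by (auto simp: z_def zero_le_mult_iff)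
  have F: "cube_image c A g \<inter> {p. w \<bullet> p = w \<bullet> v} = closed_segment v (v + g k)"
  proof (intro equalityI subsetI)
    fix p assume "p \<in> cube_image c A g \<inter> {p. w \<bullet> p = w \<bullet> v}"
    then obtain x where x: "p = c + (\<Sum>k\<in>A. x k *\<^sub>R g k)" "\<And>k. k \<in> A \<Longrightarrow> 0 \<le> x k" "\<And>k. k \<in> A \<Longrightarrow> x k \<le> 1"
      and wp: "w \<bullet> p = w \<bullet> v"
      by (auto elim: cube_imageE)
    have "(\<Sum>l\<in>B. (z l - x l) * (w \<bullet> g l)) = 0"
      using gap[of x] wp x(1) by simp
    then have "(z l - x l) * (w \<bullet> g l) = 0" if "l \<in> B" for l
      using sum_nonneg_eq_0_iff[OF B(1), of "\<lambda>l. (z l - x l) * (w \<bullet> g l)"] gap_nonneg x that B(3) by auto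
    then have "x l = z l" if "l \<in> B" for l
      using wl[OF that] that by fastforce
    then have "(\<Sum>l\<in>B. x l *\<^sub>R g l) = (\<Sum>l\<in>B. z l *\<^sub>R g l)"
      by simp
    then have "p = v + x k *\<^sub>R g k"
      using x(1) B by (simp add: v_def)
    then have "p = (1 - x k) *\<^sub>R v + x k *\<^sub>R (v + g k)"
      by (simp add: algebra_simps)
    then show "p \<in> closed_segment v (v + g k)"
      unfolding in_segment using x(2,3)[OF k] by blast
  next
    fix p assume "p \<in> closed_segment v (v + g k)"
    then obtain u where u: "0 \<le> u" "u \<le> 1" "p = v + u *\<^sub>R g k"
      by (auto simp: in_segment algebra_simps)
    have "p = c + (\<Sum>l\<in>A. (z(k := u)) l *\<^sub>R g l)"
    proof -
      have "(\<Sum>l\<in>B. (z(k := u)) l *\<^sub>R g l) = (\<Sum>l\<in>B. z l *\<^sub>R g l)"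
        by (rule sum.cong) (use B in auto)
      then show ?thesis
        using B by (simp add: u v_def)
    qed
    then have "p \<in> cube_image c A g"
      by (rule cube_imageI) (use u in \<open>auto simp: z_def\<close>)
    then show "p \<in> cube_image c A g \<inter> {p. w \<bullet> p = w \<bullet> v}"
      by (simp add: u inner_add_right wk)
  qed
  have "closed_segment v (v + g k) face_of cube_image c A g"
    unfolding F[symmetric]
  proof (rule face_of_Int_supporting_hyperplane_le[OF convex_cube_image[OF fin]])
    fix p assume "p \<in> cube_image c A g"
    then obtain x where x: "p = c + (\<Sum>k\<in>A. x k *\<^sub>R g k)" "\<And>k. k \<in> A \<Longrightarrow> 0 \<le> x k" "\<And>k. k \<in> A \<Longrightarrow> x k \<le> 1"
      by (elim cube_imageE) blast
    have "0 \<le> (\<Sum>l\<in>B. (z l - x l) * (w \<bullet> g l))"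
      by (rule sum_nonneg) (use gap_nonneg x B in auto)
    then show "w \<bullet> p \<le> w \<bullet> v"
      using gap[of x] x(1) by simp
  qed
  then show ?thesis
    using extreme_point_of_face extreme_point_of_segment by blast
qed

text \<open>
  The first bound holds because a generator is a difference of two vertices.  For the second one, the
  sum is the width of the zonotope in the \<open>i\<close>-th coordinate direction, attained between the points
  collecting the generators with positive and with nonpositive \<open>i\<close>-th coordinate, and the zonotope
  lies in the unit cube.
\<close>

lemma half_integral_generators:
  fixes g :: "'i \<Rightarrow> real ^ 'd"
  assumes fin: "finite A"
    and half: "\<And>v i. v extreme_point_of cube_image c A g \<Longrightarrow> v $ i \<in> {0, 1/2, 1}"
    and np: "\<And>k l t. k \<in> A \<Longrightarrow> l \<in> A \<Longrightarrow> k \<noteq> l \<Longrightarrow> g l \<noteq> t *\<^sub>R g k"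
  shows "k \<in> A \<Longrightarrow> \<bar>g k $ i\<bar> \<in> {0, 1/2, 1}"
    and "(\<Sum>k\<in>A. \<bar>g k $ i\<bar>) \<le> 1"
proof -
  assume k: "k \<in> A"
  then obtain v where v: "v extreme_point_of cube_image c A g" "v + g k extreme_point_of cube_image c A g"
    using cube_image_edge[OF fin k, of g c] np by metis
  show "\<bar>g k $ i\<bar> \<in> {0, 1/2, 1}"
    using half[OF v(1), of i] half[OF v(2), of i] by auto
next
  have "cube_image c A g = convex hull {v. v extreme_point_of cube_image c A g}"
    by (rule Krein_Milman_Minkowski[OF compact_cube_image[OF fin] convex_cube_image[OF fin]])
  also have "\<dots> \<subseteq> {p. 0 \<le> p $ i \<and> p $ i \<le> 1}"
  proof (rule hull_minimal)
    show "{v. v extreme_point_of cube_image c A g} \<subseteq> {p. 0 \<le> p $ i \<and> p $ i \<le> 1}"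
    proof clarify
      fix v assume "v extreme_point_of cube_image c A g"
      from half[OF this, of i] show "0 \<le> v $ i \<and> v $ i \<le> 1"
        by auto
    qed
    show "convex {p::real^'d. 0 \<le> p $ i \<and> p $ i \<le> 1}"
      by (auto simp: convex_def intro: convex_bound_le)
  qed
  finally have box: "0 \<le> p $ i" "p $ i \<le> 1" if "p \<in> cube_image c A g" for p
    using that by auto
  define hi :: "_ \<Rightarrow> real" where "hi k = (if g k $ i > 0 then 1 else 0)" for k
  have "c + (\<Sum>k\<in>A. hi k *\<^sub>R g k) \<in> cube_image c A g"
    by (rule cube_imageI) (auto simp: hi_def)
  moreover have "c + (\<Sum>k\<in>A. (1 - hi k) *\<^sub>R g k) \<in> cube_image c A g"
    by (rule cube_imageI) (auto simp: hi_def)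
  ultimately have "(\<Sum>k\<in>A. hi k * g k $ i) - (\<Sum>k\<in>A. (1 - hi k) * g k $ i) \<le> 1"
    using box(1)[of "c + (\<Sum>k\<in>A. (1 - hi k) *\<^sub>R g k)"] box(2)[of "c + (\<Sum>k\<in>A. hi k *\<^sub>R g k)"] by simp
  moreover have "(\<Sum>k\<in>A. \<bar>g k $ i\<bar>) = (\<Sum>k\<in>A. hi k * g k $ i - (1 - hi k) * g k $ i)"
    by (rule sum.cong) (auto simp: hi_def)
  ultimately show "(\<Sum>k\<in>A. \<bar>g k $ i\<bar>) \<le> 1"
    by (simp add: sum_subtractf)
qed

text \<open>
  Two nonzero entries of absolute value at least \<open>1/2\<close> already use up the bound \<open>1\<close>.
\<close>

lemma half_integral_rows:
  fixes a :: "'i \<Rightarrow> real"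
  assumes fin: "finite A"
    and half: "\<And>k. k \<in> A \<Longrightarrow> \<bar>a k\<bar> \<in> {0, 1/2, 1}"
    and sum: "(\<Sum>k\<in>A. \<bar>a k\<bar>) \<le> 1"
    and kl: "k \<in> A" "l \<in> A" "k \<noteq> l" "a k \<noteq> 0" "a l \<noteq> 0"
  shows "\<bar>a k\<bar> = \<bar>a l\<bar>" and "\<And>j. j \<in> A - {k, l} \<Longrightarrow> a j = 0"
proof -
  have "(\<Sum>k\<in>A. \<bar>a k\<bar>) = \<bar>a k\<bar> + (\<bar>a l\<bar> + (\<Sum>j\<in>A - {k} - {l}. \<bar>a j\<bar>))"
    using fin kl sum.remove[of A k "\<lambda>k. \<bar>a k\<bar>"] sum.remove[of "A - {k}" l "\<lambda>k. \<bar>a k\<bar>"] by simp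
  moreover have "(\<Sum>j\<in>A - {k} - {l}. \<bar>a j\<bar>) \<ge> 0"
    by (simp add: sum_nonneg)
  moreover have "\<bar>a k\<bar> \<ge> 1/2" "\<bar>a l\<bar> \<ge> 1/2"
    using half[OF kl(1)] half[OF kl(2)] kl by auto
  ultimately have "\<bar>a k\<bar> = 1/2" "\<bar>a l\<bar> = 1/2" "(\<Sum>j\<in>A - {k} - {l}. \<bar>a j\<bar>) = 0"
    using sum by linarith+
  then show "\<bar>a k\<bar> = \<bar>a l\<bar>" "\<And>j. j \<in> A - {k, l} \<Longrightarrow> a j = 0"
    using fin by (auto simp: sum_nonneg_eq_0_iff)
qed

section \<open>Linear relations of the generators\<close>

text \<open>
  When each coordinate involves at most two generators, with entries of equal absolute value, each of
  the equations expressing \<open>\<Sum>k\<in>A. x k *\<^sub>R g k = 0\<close> is trivial or reads \<open>x k = 0\<close> or \<open>x k = x l\<close> or \<open>x k = - x l\<close>.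
  The solution space is therefore described by the set \<open>N\<close> of the indices at which all solutions
  vanish and by the equivalence relation \<open>r\<close> on the remaining ones that links two indices when all
  solutions agree there up to a fixed sign.  Signs \<open>e\<close> can be chosen coherently in each class
  because some solution does not vanish on it.  Each class supports one relation, whose coefficients
  are all \<open>1\<close> after the change of signs; a class with one or two elements would yield a zero
  generator or two parallel ones.
\<close>

lemma signed_relation_classes:
  fixes g :: "'i \<Rightarrow> real ^ 'd"
  assumes fin: "finite A"
    and row: "\<And>i k l. k \<in> A \<Longrightarrow> l \<in> A \<Longrightarrow> k \<noteq> l \<Longrightarrow> g k $ i \<noteq> 0 \<Longrightarrow> g l $ i \<noteq> 0 \<Longrightarrow>
                \<bar>g k $ i\<bar> = \<bar>g l $ i\<bar> \<and> (\<forall>j\<in>A - {k, l}. g j $ i = 0)"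
    and nz: "\<And>k. k \<in> A \<Longrightarrow> g k \<noteq> 0"
    and np: "\<And>k l t. k \<in> A \<Longrightarrow> l \<in> A \<Longrightarrow> k \<noteq> l \<Longrightarrow> g l \<noteq> t *\<^sub>R g k"
  obtains e :: "'i \<Rightarrow> real" and N r where
    "\<And>k. k \<in> A \<Longrightarrow> e k = 1 \<or> e k = -1" "N \<subseteq> A" "equiv (A - N) r"
    "\<And>k. k \<in> A - N \<Longrightarrow> 3 \<le> card (r `` {k})"
    "\<And>x. (\<Sum>k\<in>A. x k *\<^sub>R (e k *\<^sub>R g k)) = 0 \<longleftrightarrow> (\<forall>k\<in>N. x k = 0) \<and> (\<forall>(k, l)\<in>r. x k = x l)"
proof -
  define K where "K x \<longleftrightarrow> (\<Sum>k\<in>A. x k *\<^sub>R g k) = 0" for x :: "'i \<Rightarrow> real"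
  define N where "N = {k \<in> A. \<forall>x. K x \<longrightarrow> x k = 0}"
  define sgnrel where "sgnrel s k l \<longleftrightarrow> (s = 1 \<or> s = -1) \<and> (\<forall>x. K x \<longrightarrow> x k = s * x l)" for s :: real and k l
  define r where "r = {(k, l). k \<in> A - N \<and> l \<in> A - N \<and> (\<exists>s. sgnrel s k l)}"
  have K_coord: "K x \<longleftrightarrow> (\<forall>i. (\<Sum>k\<in>A. x k * g k $ i) = 0)" for x
    unfolding K_def by (simp add: vec_eq_iff)
  have equiv: "equiv (A - N) r"
  proof (rule equivI)
    show "r \<subseteq> (A - N) \<times> (A - N)"
      by (auto simp: r_def)
    have "sgnrel 1 k k" for k
      by (simp add: sgnrel_def)
    then show "refl_on (A - N) r"
      by (auto simp: refl_on_def r_def)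
    have "sgnrel s l k" if "sgnrel s k l" for s k l
      using that by (auto simp: sgnrel_def)
    then show "sym r"
      unfolding sym_def r_def by blast
    have "sgnrel (s * t) k m" if "sgnrel s k l" "sgnrel t l m" for s t k l m
      using that by (auto simp: sgnrel_def mult.assoc)
    then show "trans r"
      unfolding trans_def r_def by blast
  qed
  \<comment> \<open>A coordinate that involves an index outside N involves only indices of its class.\<close>
  have row_class: "(j, k) \<in> r" if j: "j \<in> A - N" "g j $ i \<noteq> 0" and k: "k \<in> A" "g k $ i \<noteq> 0" for i j k
  proof (cases "j = k")
    case True
    then show ?thesis
      using equiv j by (auto simp: equiv_def refl_on_def)
  next
    case False
    have row': "\<bar>g j $ i\<bar> = \<bar>g k $ i\<bar>" "\<forall>m\<in>A - {j, k}. g m $ i = 0"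
      using row[of j k i] j k False by auto
    define s where "s = - g k $ i / g j $ i"
    have s: "s = 1 \<or> s = -1"
      using row'(1) j(2) by (auto simp: s_def abs_eq_iff)
    have xs: "x j = s * x k" if "K x" for x
    proof -
      have "0 = (\<Sum>m\<in>A. x m * g m $ i)"
        using that by (simp add: K_coord)
      also have "\<dots> = (\<Sum>m\<in>{j, k}. x m * g m $ i)"
        by (rule sum.mono_neutral_right) (use fin j k row'(2) in auto)
      finally show ?thesis
        using False j(2) by (simp add: s_def field_simps)
    qed
    then have "sgnrel s j k"
      using s by (auto simp: sgnrel_def)
    moreover have "k \<notin> N"
      using j(1) xs by (fastforce simp: N_def)
    ultimately show ?thesis
      using j k by (auto simp: r_def)
  qed
  \<comment> \<open>Signs are measured against one representative of each class.\<close>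
  define rep where "rep k = (SOME m. m \<in> r `` {k})" for k
  have rep: "(k, rep k) \<in> r" if "k \<in> A - N" for k
    using someI[of "\<lambda>m. m \<in> r `` {k}" k] that equiv by (auto simp: rep_def equiv_def refl_on_def)
  have rep_eq: "rep k = rep l" if "(k, l) \<in> r" for k l
    using equiv_class_eq[OF equiv that] by (simp add: rep_def)
  have "\<forall>k\<in>A - N. \<exists>s. sgnrel s k (rep k)"
    using rep by (auto simp: r_def)
  then obtain e0 where e0: "\<And>k. k \<in> A - N \<Longrightarrow> sgnrel (e0 k) k (rep k)"
    by metis
  define e where "e k = (if k \<in> A - N then e0 k else 1)" for k
  have e: "e k = 1 \<or> e k = -1" for k
    using e0[of k] by (auto simp: e_def sgnrel_def)
  have ee: "e k * e k = 1" for k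
    using e[of k] by auto
  have e_rep: "x k = e k * x (rep k)" if "K x" "k \<in> A - N" for x k
    using e0[OF that(2)] that by (simp add: e_def sgnrel_def)
  have K_signed: "(\<Sum>k\<in>A. x k *\<^sub>R (e k *\<^sub>R g k)) = 0 \<longleftrightarrow> K (\<lambda>k. x k * e k)" for x
    by (simp add: K_def)
  have kernel: "K (\<lambda>k. x k * e k) \<longleftrightarrow> (\<forall>k\<in>N. x k = 0) \<and> (\<forall>(k, l)\<in>r. x k = x l)" (is "_ \<longleftrightarrow> ?P x") for x
  proof
    assume Kx: "K (\<lambda>k. x k * e k)"
    have x_rep: "x k = x (rep k) * e (rep k)" if "k \<in> A - N" for k
    proof -
      have "x k * (e k * e k) = x (rep k) * e (rep k) * (e k * e k)"
        using e_rep[OF Kx that] by (simp add: mult.assoc mult.commute mult.left_commute)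
      then show ?thesis
        by (simp add: ee)
    qed
    have "x k = x l" if "(k, l) \<in> r" for k l
    proof -
      have "k \<in> A - N" "l \<in> A - N"
        using that by (auto simp: r_def)
      then show ?thesis
        using x_rep[of k] x_rep[of l] rep_eq[OF that] by metis
    qed
    moreover have "x k = 0" if "k \<in> N" for k
      using that Kx e[of k] by (auto simp: N_def)
    ultimately show "?P x"
      by blast
  next
    assume P: "?P x"
    show "K (\<lambda>k. x k * e k)"
      unfolding K_coord
    proof
      fix i
      show "(\<Sum>k\<in>A. x k * e k * g k $ i) = 0"
      proof (cases "\<exists>j\<in>A - N. g j $ i \<noteq> 0")
        case False
        then show ?thesis
          using P by (intro sum.neutral) auto
      next
        case True
        then obtain j where j: "j \<in> A - N" "g j $ i \<noteq> 0"
          by blast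
        \<comment> \<open>On the class of j, the signed coefficients of x are proportional to any solution z that does
            not vanish there, and the i-th coordinate sees no other index.\<close>
        then obtain z where z: "K z" "z j \<noteq> 0"
          by (auto simp: N_def)
        have zrep: "z (rep j) \<noteq> 0"
          using e_rep[OF z(1) j(1)] z(2) by auto
        have "(\<Sum>k\<in>A. x k * e k * g k $ i) = (\<Sum>k\<in>A. (x j / z (rep j)) * (z k * g k $ i))"
        proof (rule sum.cong)
          fix k assume k: "k \<in> A"
          show "x k * e k * g k $ i = (x j / z (rep j)) * (z k * g k $ i)"
          proof (cases "g k $ i = 0")
            case False
            have jk: "(j, k) \<in> r"
              by (rule row_class[OF j k False])
            then have "x k = x j"
              using P by fastforce
            moreover have "z k = e k * z (rep j)"
              using rep_eq[OF jk] e_rep[OF z(1), of k] jk by (auto simp: r_def)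
            ultimately show ?thesis
              using zrep by simp
          qed simp
        qed simp
        also have "\<dots> = 0"
          unfolding sum_distrib_left[symmetric] using z(1) by (simp add: K_coord)
        finally show ?thesis .
      qed
    qed
  qed
  have "3 \<le> card (r `` {k})" if k: "k \<in> A - N" for k
  proof (rule ccontr)
    assume small: "\<not> 3 \<le> card (r `` {k})"
    let ?C = "r `` {k}"
    have C: "?C \<subseteq> A - N" "k \<in> ?C"
      using equiv k by (auto simp: r_def equiv_def refl_on_def)
    have finC: "finite ?C"
      using C(1) fin finite_subset by blast
    have const: "m \<in> ?C \<longleftrightarrow> n \<in> ?C" if "(m, n) \<in> r" for m n
      using that equiv unfolding equiv_def sym_def trans_def Image_singleton_iff by blast
    \<comment> \<open>The indicator function of a class, with signs, is a relation.\<close>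
    have "K (\<lambda>m. (if m \<in> ?C then 1 else 0) * e m)"
      unfolding kernel
    proof (intro conjI ballI; clarify?)
      show "(if m \<in> ?C then 1 else 0) = (0::real)" if "m \<in> N" for m
        using that C(1) by auto
      show "(if m \<in> ?C then 1 else 0) = (if n \<in> ?C then 1 else (0::real))" if "(m, n) \<in> r" for m n
        by (simp only: const[OF that])
    qed
    then have "0 = (\<Sum>m\<in>A. ((if m \<in> ?C then 1 else 0) * e m) *\<^sub>R g m)"
      by (simp add: K_def)
    also have "\<dots> = (\<Sum>m\<in>?C. e m *\<^sub>R g m)"
      by (rule sum.mono_neutral_cong_right) (use fin C in auto)
    also have "\<dots> = e k *\<^sub>R g k + (\<Sum>m\<in>?C - {k}. e m *\<^sub>R g m)"
      by (rule sum.remove[OF finC C(2)])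
    finally have rel: "e k *\<^sub>R g k + (\<Sum>m\<in>?C - {k}. e m *\<^sub>R g m) = 0"
      by simp
    have "card (?C - {k}) \<le> 1"
      using small C finC by simp
    then consider "?C - {k} = {}" | l where "?C - {k} = {l}"
      using finC by (metis card_0_eq card_1_singletonE finite_Diff le_Suc_eq le_zero_eq One_nat_def)
    then show False
    proof cases
      case 1
      then have "e k *\<^sub>R g k = 0"
        using rel unfolding 1 by simp
      then show False
        using nz[of k] k e[of k] by auto
    next
      case 2
      then have l: "l \<in> A" "k \<noteq> l"
        using C(1) by auto
      have "g l = e l *\<^sub>R (e l *\<^sub>R g l)"
        by (simp add: ee)
      also have "e l *\<^sub>R g l = - (e k *\<^sub>R g k)"
        using rel unfolding 2 by (simp add: add_eq_0_iff)
      finally have "g l = (- (e l * e k)) *\<^sub>R g k"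
        by simp
      then show False
        using np[OF _ l] k by blast
    qed
  qed
  then show thesis
    using that[of e N r] e equiv kernel K_signed by (auto simp: N_def)
qed

section \<open>A graph with prescribed cycles\<close>

text \<open>
  Arrange the set in a circle and move every element to its successor.
\<close>

lemma ex_cyclic_permutation:
  assumes card: "3 \<le> card C"
  shows "\<exists>\<pi>. bij_betw \<pi> C C \<and> (\<forall>k\<in>C. \<pi> k \<noteq> k \<and> \<pi> (\<pi> k) \<noteq> k) \<and>
             (\<forall>x :: 'a \<Rightarrow> real. (\<forall>k\<in>C. x (\<pi> k) = x k) \<longrightarrow> (\<forall>k\<in>C. \<forall>l\<in>C. x k = x l))"
proof -
  have fin: "finite C"
    using card by (intro card_ge_0_finite) simp
  define n where "n = card C"
  have n: "3 \<le> n"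
    using card by (simp add: n_def)
  obtain f where f: "bij_betw f {0..<n} C"
    using ex_bij_betw_nat_finite[OF fin] by (auto simp: n_def)
  define \<pi> where "\<pi> k = f (Suc (inv_into {0..<n} f k) mod n)" for k
  have f_inj: "f i = f j \<longleftrightarrow> i = j" if "i < n" "j < n" for i j
    using f that by (auto simp: bij_betw_def inj_on_def)
  have C: "C = f ` {0..<n}"
    using f by (simp add: bij_betw_def)
  have \<pi>_f: "\<pi> (f i) = f (Suc i mod n)" if "i < n" for i
    using f that by (simp add: \<pi>_def bij_betw_def)
  have "C \<subseteq> \<pi> ` C"
  proof
    fix k assume "k \<in> C"
    then obtain j where j: "j < n" "k = f j"
      by (auto simp: C)
    have "\<exists>i<n. Suc i mod n = j"
    proof (cases j)
      case 0
      then show ?thesis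
        using n by (intro exI[of _ "n - 1"]) auto
    next
      case (Suc i)
      then show ?thesis
        using j by (intro exI[of _ i]) auto
    qed
    then show "k \<in> \<pi> ` C"
      using j \<pi>_f by (force simp: C)
  qed
  moreover have "\<pi> ` C \<subseteq> C"
    using \<pi>_f n by (auto simp: C)
  ultimately have "bij_betw \<pi> C C"
    using fin by (simp add: bij_betw_def finite_surj_inj subset_antisym)
  moreover have "\<pi> k \<noteq> k \<and> \<pi> (\<pi> k) \<noteq> k" if "k \<in> C" for k
  proof -
    obtain i where i: "i < n" "k = f i"
      using \<open>k \<in> C\<close> unfolding C by auto
    \<comment> \<open>This is where three elements are needed: on two, the successor map is an involution.\<close>
    have "Suc i mod n \<noteq> i" "Suc (Suc i mod n) mod n \<noteq> i"
      using i n by (auto simp: mod_Suc)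
    then show ?thesis
      using i n by (simp add: \<pi>_f f_inj)
  qed
  moreover have "x k = x l" if inv: "\<forall>k\<in>C. x (\<pi> k) = x k" and kl: "k \<in> C" "l \<in> C" for x :: "'a \<Rightarrow> real" and k l
  proof -
    have "x (f i) = x (f 0)" if "i < n" for i
      using that
    proof (induction i)
      case (Suc i)
      then have "x (f (Suc i)) = x (\<pi> (f i))"
        by (simp add: \<pi>_f)
      also have "\<dots> = x (f i)"
        using inv Suc.prems by (auto simp: C)
      finally show ?case
        using Suc by simp
    qed simp
    then have "x m = x (f 0)" if "m \<in> C" for m
      using that unfolding C atLeast0LessThan by blast
    from this[OF kl(1)] this[OF kl(2)] show ?thesis
      by (rule trans[OF _ sym])
  qed
  ultimately show ?thesis
    by (intro exI[of _ \<pi>]) simp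
qed

text \<open>
  Rotating each equivalence class separately makes the classes the orbits; a function is invariant
  under the permutation iff it is constant on the classes.  The conditions \<open>\<pi> k \<noteq> k\<close> and
  \<open>\<pi> (\<pi> k) \<noteq> k\<close> will exclude loops and double edges.
\<close>

lemma ex_permutation_with_orbits:
  assumes fin: "finite B" and equiv: "equiv B r"
    and card: "\<And>k. k \<in> B \<Longrightarrow> 3 \<le> card (r `` {k})"
  obtains \<pi> where "bij_betw \<pi> B B" "\<And>k. k \<in> B \<Longrightarrow> \<pi> k \<noteq> k" "\<And>k. k \<in> B \<Longrightarrow> \<pi> (\<pi> k) \<noteq> k"
    "\<And>x :: 'a \<Rightarrow> real. (\<forall>k\<in>B. x (\<pi> k) = x k) \<longleftrightarrow> (\<forall>(k, l)\<in>r. x k = x l)"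
proof -
  define cyc where "cyc C \<pi> \<longleftrightarrow> bij_betw \<pi> C C \<and> (\<forall>k\<in>C. \<pi> k \<noteq> k \<and> \<pi> (\<pi> k) \<noteq> k) \<and>
      (\<forall>x :: 'a \<Rightarrow> real. (\<forall>k\<in>C. x (\<pi> k) = x k) \<longrightarrow> (\<forall>k\<in>C. \<forall>l\<in>C. x k = x l))" for C \<pi>
  have rB: "r \<subseteq> B \<times> B"
    using equiv by (simp add: equiv_def)
  have ex: "\<exists>\<pi>. cyc C \<pi>" if "3 \<le> card C" for C
    using ex_cyclic_permutation[OF that] unfolding cyc_def .
  define F where "F C = (SOME \<pi>. cyc C \<pi>)" for C
  have F_cyc: "cyc C (F C)" if "3 \<le> card C" for C
    unfolding F_def by (rule someI_ex[OF ex[OF that]])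
  have F_bij: "bij_betw (F (r `` {k})) (r `` {k}) (r `` {k})"
    and F_moves: "\<And>m. m \<in> r `` {k} \<Longrightarrow> F (r `` {k}) m \<noteq> m \<and> F (r `` {k}) (F (r `` {k}) m) \<noteq> m"
    and F_trans: "\<And>(x :: 'a \<Rightarrow> real) m n. (\<And>m. m \<in> r `` {k} \<Longrightarrow> x (F (r `` {k}) m) = x m) \<Longrightarrow>
      m \<in> r `` {k} \<Longrightarrow> n \<in> r `` {k} \<Longrightarrow> x m = x n"
    if "k \<in> B" for k
    using F_cyc[OF card[OF that]] unfolding cyc_def by simp_all
  define \<pi> where "\<pi> k = F (r `` {k}) k" for k
  have refl: "(k, k) \<in> r" if "k \<in> B" for k
    using equiv that by (simp add: equiv_def refl_on_def)
  have \<pi>_r: "(k, \<pi> k) \<in> r" if "k \<in> B" for k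
    using bij_betwE[OF F_bij[OF that]] refl[OF that] by (simp add: \<pi>_def)
  have \<pi>_class: "r `` {\<pi> k} = r `` {k}" if "k \<in> B" for k
    using equiv_class_eq[OF equiv \<pi>_r[OF that]] by simp
  have \<pi>_B: "\<pi> k \<in> B" if "k \<in> B" for k
    using \<pi>_r[OF that] rB by blast
  have "inj_on \<pi> B"
  proof (rule inj_onI)
    fix k l assume kl: "k \<in> B" "l \<in> B" "\<pi> k = \<pi> l"
    then have eq: "r `` {k} = r `` {l}"
      using \<pi>_class by metis
    then have "l \<in> r `` {k}" "k \<in> r `` {k}"
      using refl kl by auto
    moreover have "F (r `` {k}) k = F (r `` {k}) l"
      using kl(3) by (simp add: \<pi>_def eq)
    ultimately show "k = l"
      using F_bij[OF kl(1)] unfolding bij_betw_def inj_on_def by blast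
  qed
  then have "bij_betw \<pi> B B"
    using \<pi>_B fin by (auto simp: bij_betw_def endo_inj_surj image_subset_iff)
  moreover have "\<pi> k \<noteq> k" "\<pi> (\<pi> k) \<noteq> k" if "k \<in> B" for k
    using F_moves[OF that, of k] refl[OF that] \<pi>_class[OF that] by (simp_all add: \<pi>_def)
  moreover have "(\<forall>k\<in>B. x (\<pi> k) = x k) \<longleftrightarrow> (\<forall>(k, l)\<in>r. x k = x l)" for x :: "'a \<Rightarrow> real"
  proof
    assume inv: "\<forall>k\<in>B. x (\<pi> k) = x k"
    have "x k = x l" if kl: "(k, l) \<in> r" for k l
    proof -
      have k: "k \<in> B"
        using kl rB by blast
      have "x (F (r `` {k}) m) = x m" if "m \<in> r `` {k}" for m
      proof -
        have "r `` {m} = r `` {k}"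
          using equiv_class_eq[OF equiv, of k m] that by simp
        moreover have "x (\<pi> m) = x m"
          using inv that rB by blast
        ultimately show ?thesis
          by (simp add: \<pi>_def)
      qed
      then show ?thesis
        using F_trans[OF k, of x k l] refl[OF k] kl by simp
    qed
    then show "\<forall>(k, l)\<in>r. x k = x l"
      by blast
  next
    assume "\<forall>(k, l)\<in>r. x k = x l"
    then show "\<forall>k\<in>B. x (\<pi> k) = x k"
      using \<pi>_r by fastforce
  qed
  ultimately show thesis
    using that by blast
qed

lemma lookup_scaleR_basis_vec:
  "Poly_Mapping.lookup (r *\<^sub>R basis_vec v) w = (if v = w then r else 0)"
proof -
  have "finite {k. r * Poly_Mapping.lookup (Poly_Mapping.single v (1::real)) k \<noteq> 0}"
    by (rule finite_subset[of _ "{v}"]) (auto simp: lookup_single)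
  then show ?thesis
    by (simp add: basis_vec_def scaleR_poly_mapping_def lookup_single when_def)
qed

text \<open>
  The graph has one edge for each \<open>k\<in>A\<close>, with tail \<open>2 * k\<close>.  For \<open>k\<in>N\<close> its head is the odd vertex
  \<open>2 * k + 1\<close>, which no other edge meets, so its edge vector occurs in no linear relation.  The
  remaining edges run along the orbits of \<open>\<pi>\<close>; comparing coefficients at the common vertex
  \<open>2 * \<pi> k\<close> of two consecutive edges shows that the coefficients of a relation are constant along an
  orbit.
\<close>

lemma permutation_graph_relations:
  fixes N A :: "nat set"
  assumes fin: "finite A" and NA: "N \<subseteq> A" and bij: "bij_betw \<pi> (A - N) (A - N)"
  defines "head \<equiv> \<lambda>k. if k \<in> N then 2 * k + 1 else 2 * \<pi> k"
  shows "(\<Sum>k\<in>A. x k *\<^sub>R (basis_vec (head k) - basis_vec (2 * k))) = 0 \<longleftrightarrow>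
         (\<forall>k\<in>N. x k = 0) \<and> (\<forall>k\<in>A - N. x (\<pi> k) = x k)" (is "?S = 0 \<longleftrightarrow> ?P")
proof
  assume S: "?S = 0"
  have lookup: "(\<Sum>k\<in>A. (if head k = v then x k else 0) - (if 2 * k = v then x k else 0)) = 0" for v
  proof -
    have "0 = Poly_Mapping.lookup ?S v"
      by (simp add: S)
    also have "\<dots> = (\<Sum>k\<in>A. (if head k = v then x k else 0) - (if 2 * k = v then x k else 0))"
      by (simp add: lookup_sum lookup_minus lookup_scaleR_basis_vec scaleR_diff_right)
    finally show ?thesis by simp
  qed
  show ?P
  proof (intro conjI ballI)
    fix k assume k: "k \<in> N"
    have "head j = 2 * k + 1 \<longleftrightarrow> j = k" "2 * j \<noteq> 2 * k + 1" for j
      using k unfolding head_def by (auto, presburger+)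
    then have "(\<Sum>j\<in>A. if j = k then x j else 0) = 0"
      using lookup[of "2 * k + 1"] by simp
    then show "x k = 0"
      using fin k NA by (auto simp: sum.delta)
  next
    fix k assume k: "k \<in> A - N"
    have \<pi>k: "\<pi> k \<in> A - N"
      using k bij by (auto simp: bij_betw_def)
    have inj: "\<pi> j = \<pi> k \<longleftrightarrow> j = k" if "j \<in> A - N" for j
      using that k bij by (auto simp: bij_betw_def inj_on_def)
    have head: "head j = 2 * \<pi> k \<longleftrightarrow> j = k" if "j \<in> A" for j
    proof (cases "j \<in> N")
      case True
      then have "head j \<noteq> 2 * \<pi> k"
        unfolding head_def by presburger
      then show ?thesis
        using True k by auto
    next
      case False
      then show ?thesis
        using inj that by (simp add: head_def)
    qed
    have "(\<Sum>j\<in>A. (if j = k then x j else 0) - (if j = \<pi> k then x j else 0)) =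
        (\<Sum>j\<in>A. (if head j = 2 * \<pi> k then x j else 0) - (if 2 * j = 2 * \<pi> k then x j else 0))"
      by (rule sum.cong) (simp_all add: head)
    also have "\<dots> = 0"
      by (rule lookup)
    finally have "x k - x (\<pi> k) = 0"
      using fin k \<pi>k by (simp add: sum_subtractf)
    then show "x (\<pi> k) = x k"
      by simp
  qed
next
  assume P: ?P
  have "?S = (\<Sum>k\<in>A - N. x k *\<^sub>R (basis_vec (head k) - basis_vec (2 * k)))"
    by (rule sum.mono_neutral_right) (use fin P in auto)
  also have "\<dots> = (\<Sum>k\<in>A - N. x (\<pi> k) *\<^sub>R basis_vec (2 * \<pi> k) - x k *\<^sub>R basis_vec (2 * k))"
    by (rule sum.cong) (use P in \<open>auto simp: head_def scaleR_diff_right\<close>)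
  also have "\<dots> = 0"
    using sum.reindex_bij_betw[OF bij, of "\<lambda>k. x k *\<^sub>R basis_vec (2 * k)"] by (simp add: sum_subtractf)
  finally show "?S = 0" .
qed

lemma graphical_zonotope_eq_cube_image:
  assumes fin: "finite A" and inj: "inj_on (\<lambda>k. {tail k, head k}) A"
  shows "graphical_zonotope ((\<lambda>k. {tail k, head k}) ` A) =
    cube_image (\<Sum>k\<in>A. basis_vec (tail k)) A (\<lambda>k. basis_vec (head k) - basis_vec (tail k))"
proof -
  have "graphical_zonotope ((\<lambda>k. {tail k, head k}) ` A) = (\<Sum>k\<in>A. closed_segment (basis_vec (tail k)) (basis_vec (head k)))"
    unfolding graphical_zonotope_def by (simp add: sum.reindex[OF inj] segment_convex_hull)
  then show ?thesis
    by (simp add: sum_closed_segment_eq_cube_image[OF fin])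
qed

text \<open>
  The generators of \<open>Z\<close>, after a change of signs, and the edge vectors of a disjoint union of cycles
  and single edges satisfy the same linear relations.
\<close>

theorem theorem1p3:
  fixes Z :: "(real ^ 'd) set"
  assumes "half_integral_zonotope Z"
  shows "\<exists>(V :: nat set) (E :: nat set set) (f :: real ^ 'd \<Rightarrow> nat \<Rightarrow>\<^sub>0 real).
           finite_simple_graph V E \<and>
           affine_map_on (affine hull Z) f \<and>
           bij_betw f (affine hull Z) (affine hull (graphical_zonotope E)) \<and>
           f ` Z = graphical_zonotope E"
proof -
  obtain m a b where Z0: "Z = (\<Sum>k<(m::nat). closed_segment (a k) (b k))"
    and half: "\<And>v i. v extreme_point_of Z \<Longrightarrow> v $ i \<in> {0, 1/2, 1}"
    using assms unfolding half_integral_zonotope_def zonotope_def by blast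
  have "Z = cube_image (\<Sum>k<m. a k) {..<m} (\<lambda>k. b k - a k)"
    unfolding Z0 by (rule sum_closed_segment_eq_cube_image) simp
  then obtain c and A :: "nat set" and g where fin: "finite A" and Z: "Z = cube_image c A g"
    and nz: "\<And>k. k \<in> A \<Longrightarrow> g k \<noteq> 0"
    and np: "\<And>k l t. k \<in> A \<Longrightarrow> l \<in> A \<Longrightarrow> k \<noteq> l \<Longrightarrow> g l \<noteq> t *\<^sub>R g k"
    by (rule irredundant_cube_image[OF finite_lessThan]) (rule that)
  have half': "v $ i \<in> {0, 1/2, 1}" if "v extreme_point_of cube_image c A g" for v i
    using half that unfolding Z .
  note gens = half_integral_generators[where c = c and A = A and g = g, OF fin half' np]
  have row: "\<bar>g k $ i\<bar> = \<bar>g l $ i\<bar> \<and> (\<forall>j\<in>A - {k, l}. g j $ i = 0)"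
    if kl: "k \<in> A" "l \<in> A" "k \<noteq> l" "g k $ i \<noteq> 0" "g l $ i \<noteq> 0" for i k l
    using half_integral_rows[where A = A and a = "\<lambda>k. g k $ i", OF fin gens kl] by blast
  obtain e N r where e: "\<And>k. k \<in> A \<Longrightarrow> e k = 1 \<or> e k = -1" and NA: "N \<subseteq> A" and r: "equiv (A - N) r"
    and card: "\<And>k. k \<in> A - N \<Longrightarrow> 3 \<le> card (r `` {k})"
    and rel: "\<And>x. (\<Sum>k\<in>A. x k *\<^sub>R (e k *\<^sub>R g k)) = 0 \<longleftrightarrow> (\<forall>k\<in>N. x k = 0) \<and> (\<forall>(k, l)\<in>r. x k = x l)"
    by (rule signed_relation_classes[OF fin row nz np]) (assumption+, rule that)
  obtain \<pi> where bij: "bij_betw \<pi> (A - N) (A - N)"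
    and \<pi>: "\<And>k. k \<in> A - N \<Longrightarrow> \<pi> k \<noteq> k" "\<And>k. k \<in> A - N \<Longrightarrow> \<pi> (\<pi> k) \<noteq> k"
    and orbits: "\<And>x :: nat \<Rightarrow> real. (\<forall>k\<in>A - N. x (\<pi> k) = x k) \<longleftrightarrow> (\<forall>(k, l)\<in>r. x k = x l)"
    by (rule ex_permutation_with_orbits[OF finite_Diff[OF fin] r card]) (assumption+, rule that)
  define head where "head k = (if k \<in> N then 2 * k + 1 else 2 * \<pi> k)" for k
  define E where "E = (\<lambda>k. {2 * k, head k}) ` A"
  \<comment> \<open>The base point after the generators with sign -1 have been reversed.\<close>
  define d where "d = c + (\<Sum>k\<in>A. if e k = 1 then 0 else g k)"
  have Z': "Z = cube_image d A (\<lambda>k. e k *\<^sub>R g k)"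
    unfolding Z d_def by (rule cube_image_flip[OF e])
  have head_eq: "head k = 2 * l \<longleftrightarrow> k \<notin> N \<and> \<pi> k = l" for k l
  proof -
    have "2 * k + 1 \<noteq> 2 * l"
      by presburger
    then show ?thesis
      by (simp add: head_def)
  qed
  \<comment> \<open>Two edges with the same ends would form a cycle of length two of the permutation.\<close>
  have inj: "inj_on (\<lambda>k. {2 * k, head k}) A"
  proof (rule inj_onI, rule ccontr)
    fix k l assume kl: "k \<in> A" "l \<in> A" "{2 * k, head k} = {2 * l, head l}" "k \<noteq> l"
    then have "head k = 2 * l" "head l = 2 * k"
      by (auto simp: doubleton_eq_iff)
    then show False
      using \<pi>(2)[of k] kl by (auto simp: head_eq)
  qed
  have "finite_simple_graph (insert 0 (\<Union>E)) E"
    unfolding finite_simple_graph_def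
  proof (intro conjI ballI)
    fix e assume "e \<in> E"
    then obtain k where k: "k \<in> A" "e = {2 * k, head k}"
      by (auto simp: E_def)
    have "head k \<noteq> 2 * k"
      using \<pi>(1)[of k] k by (auto simp: head_eq)
    then show "card e = 2"
      using k by simp
  qed (use fin in \<open>auto simp: E_def\<close>)
  moreover have graph: "graphical_zonotope E =
      cube_image (\<Sum>k\<in>A. basis_vec (2 * k)) A (\<lambda>k. basis_vec (head k) - basis_vec (2 * k))"
    unfolding E_def by (rule graphical_zonotope_eq_cube_image[OF fin inj])
  moreover have "(\<Sum>k\<in>A. x k *\<^sub>R (e k *\<^sub>R g k)) = 0 \<longleftrightarrow>
      (\<Sum>k\<in>A. x k *\<^sub>R (basis_vec (head k) - basis_vec (2 * k))) = 0" for x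
    unfolding rel orbits[symmetric]
    using permutation_graph_relations[OF fin NA bij, of x] by (simp add: head_def)
  then have "\<exists>f. affine_map_on (affine hull Z) f \<and>
             bij_betw f (affine hull Z) (affine hull (graphical_zonotope E)) \<and>
             f ` Z = graphical_zonotope E"
    unfolding graph Z' by (rule affine_equivalence_of_same_relations[OF fin])
  ultimately show ?thesis
    by blast
qed

end
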